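(* Let $T,C,\kappa,k\ge1$ be integers, $\varepsilon>0$, let $W\in\mathbb{R}^{C\times\kappa}$, let $K:\mathbb{R}^{3\times T}\to\mathbb{R}^{3\times C\times T}$ be the axis-shared circular convolution operator with kernel bank $W$, let $\psi:\mathbb{R}_{\ge0}\to\mathbb{R}$ be any function, and for $x\in\mathbb{R}^{3\times T}$ define $\tilde y(x)\in\mathbb{R}^{C\times T}$ by $$\tilde y_c(t)=\psi\Big(\big\|(K(x)_{a,c}(t))_{a\in\{x,y,z\}}\big\|_2\Big).$$ 1. For every $x\in\mathbb{R}^{3\times T}$, every $R\in\mathrm{O}(3)$ and every $\tau\in C_T=\mathbb{Z}/T\mathbb{Z}$, $$\tilde y(Rx)=\tilde y(x),\qquad \mathrm{GAP}_t\big(\tau_\Delta\,\tilde y(x)\big)=\mathrm{GAP}_t\big(\tilde y(x)\big).$$ 2. For each sensor $s\in\{\mathrm{ACC},\mathrm{GYR}\}$ with stream $x\in\mathbb{R}^{3\times T}$ and every $\lambda_s>0$: $\mathcal N_s(\lambda_s x)=\mathcal N_s(x)$ if $\sqrt{R_s(x)}\ge\varepsilon$ and $\lambda_s\sqrt{R_s(x)}\ge\varepsilon$; and $r_s(\lambda_s x)=r_s(x)+\log\lambda_s$ if $R_s(x)>0$. 3. Consequently the head descriptor $z$ (defined in the context, for two-sensor inputs $x=(x_{\mathrm{ACC}},x_{\mathrm{GYR}})\in(\mathbb{R}^{3\times T})^2$) is invariant to $C_T\times\mathrm{O}(3)$, i.e. $z(R\,\tau_\Delta x)=z(x)$ for all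 $\tau\in C_T$, $R\in\mathrm{O}(3)$ (both acting simultaneously on the two sensor streams), and it is affine in $\log\Lambda\cong\mathbb{R}^2$ along the log-RMS coordinates: for every $\lambda=(\lambda_{\mathrm{ACC}},\lambda_{\mathrm{GYR}})\in\Lambda=\mathbb{R}_{>0}^{\{\mathrm{ACC},\mathrm{GYR}\}}$, if $\sqrt{R_s(x_s)}\ge\varepsilon$ and $\lambda_s\sqrt{R_s(x_s)}\ge\varepsilon$ for both $s$, then $z(\lambda\odot x)=z(x)+E_{\log}(\log\lambda_{\mathrm{ACC}},\log\lambda_{\mathrm{GYR}})$, where $\lambda\odot x=(\lambda_{\mathrm{ACC}}x_{\mathrm{ACC}},\lambda_{\mathrm{GYR}}x_{\mathrm{GYR}})$ and $E_{\log}$ is the inclusion of $\mathbb{R}^2$ as the two log-RMS coordinates.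
   Context: Signals are arrays indexed by channels and by time $t\in\mathbb{Z}/T\mathbb{Z}$. A tri-axial stream is $x=(x_a(t))\in\mathbb{R}^{3\times T}$, $a\in\{x,y,z\}$. $R\in\mathrm{O}(3)$ acts by $(Rx)(t)=R\,x(t)$, on the axis index. The cyclic shift by $\tau$ is $(\tau_\Delta f)(t)=f(t-\tau\bmod T)$, on every channel. Global average pooling over time is $\mathrm{GAP}_t(f)=\frac1T\sum_{t}f(t)$, per channel. The axis-shared operator $K$ applies the same temporal filters to each axis with circular padding: $K(x)_{a,c}(t)=\sum_{j=0}^{\kappa-1}W(c,j)\,x_a(t-j\bmod T)$. Gain processing: for a sensor $s\in\{\mathrm{ACC},\mathrm{GYR}\}$ with stream $x\in\mathbb{R}^{3\times T}$ and fixed floor $\varepsilon>0$, $$R_s(x)=\frac1{3T}\sum_{a}\sum_{t}x_a(t)^2,\quad \rho^{\mathrm{norm}}_s(x)=\max(\varepsilon,\sqrt{R_s(x)}),\quad \mathcal N_s(x)=\frac{x}{\rho^{\mathrm{norm}}_s(x)},\quad r_s(x)=\tfrac12\log R_s(x),$$ with the convention $r_s(x)=-\infty$ if $R_s(x)=0$. $\mathrm{Box}^{\circlearrowleft}_k$ is the depthwise circular $k$-tap average $(\mathrm{Box}^{\circlearrowleft}_kf)(t)=\frac1k\sum_{j=0}^{k-1}f(t-j\bmod T)$ on each channel. The head descriptor applies $\mathrm{GAP}_t$ to the smoothed $\tilde y$ of the normalized sensor streams and concatenates the (time-constant) log-RMS values: $$z(x)=\Big(\mathrm{GAP}_t\mathrm{Box}^{\circlearrowleft}_k\,\tilde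 y(\mathcal N_{\mathrm{ACC}}(x_{\mathrm{ACC}})),\ \mathrm{GAP}_t\mathrm{Box}^{\circlearrowleft}_k\,\tilde y(\mathcal N_{\mathrm{GYR}}(x_{\mathrm{GYR}})),\ r_{\mathrm{ACC}}(x_{\mathrm{ACC}}),\ r_{\mathrm{GYR}}(x_{\mathrm{GYR}})\Big).$$ The last two entries are the log-RMS coordinates. *)

theory Defs
  imports "HOL-Analysis.Analysis" "Berlekamp_Zassenhaus.Finite_Field"
begin

text \<open>
  Time is the cyclic group Z/TZ, represented by \<open>'t mod_ring\<close> with \<open>T = CARD('t)\<close>; its
  subtraction is modulo \<open>T\<close>, and \<open>T = 1\<close> is allowed. A signal with channel set \<open>'ch\<close> is an
  element of \<open>real ^ 't mod_ring ^ 'ch\<close>, and \<open>f $ c $ t\<close> is channel \<open>c\<close> at time \<open>t\<close>.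
  The three axes are the elements of the type \<open>3\<close>.
\<close>

type_synonym ('t, 'ch) signal = "((real, 't mod_ring) vec, 'ch) vec"

type_synonym 't stream = "('t, 3) signal"

definition sample :: "('t::finite, 'ch::finite) signal \<Rightarrow> 't mod_ring \<Rightarrow> real ^ 'ch" where
  "sample f t = (\<chi> c. f $ c $ t)"

definition axis_act :: "real ^ 3 ^ 3 \<Rightarrow> 't::finite stream \<Rightarrow> 't stream" where
  "axis_act R x = (\<chi> a t. (R *v sample x t) $ a)"

definition shift :: "'t::finite mod_ring \<Rightarrow> ('t, 'ch::finite) signal \<Rightarrow> ('t, 'ch) signal" where
  "shift \<tau> f = (\<chi> c t. f $ c $ (t - \<tau>))"

definition GAP :: "('t::finite, 'ch::finite) signal \<Rightarrow> real ^ 'ch" where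
  "GAP f = (\<chi> c. 1 / real CARD('t) * (\<Sum>t\<in>UNIV. f $ c $ t))"

text \<open>
  Tap offsets are natural numbers reduced modulo \<open>T\<close>, so the number of taps may exceed \<open>T\<close>.
  Only the entries \<open>W c j\<close> with \<open>j < \<kappa>\<close> of the kernel bank are used.
\<close>

definition circ_conv ::
  "nat \<Rightarrow> ('c::finite \<Rightarrow> nat \<Rightarrow> real) \<Rightarrow> 't::finite stream \<Rightarrow> ((('t, 'c) signal), 3) vec" where
  "circ_conv \<kappa> W x =
     (\<chi> a c t. \<Sum>j<\<kappa>. W c j * x $ a $ (t - of_int_mod_ring (int j)))"

definition box :: "nat \<Rightarrow> ('t::finite, 'ch::finite) signal \<Rightarrow> ('t, 'ch) signal" where
  "box k f = (\<chi> c t. 1 / real k * (\<Sum>j<k. f $ c $ (t - of_int_mod_ring (int j))))"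

text \<open>
  The function \<open>\<psi>\<close> is only evaluated at norms, so its values at negative reals are irrelevant.
\<close>

definition ytilde ::
  "nat \<Rightarrow> ('c::finite \<Rightarrow> nat \<Rightarrow> real) \<Rightarrow> (real \<Rightarrow> real) \<Rightarrow> 't::finite stream \<Rightarrow> ('t, 'c) signal" where
  "ytilde \<kappa> W \<psi> x = (\<chi> c t. \<psi> (norm (\<chi> a. circ_conv \<kappa> W x $ a $ c $ t)))"

text \<open>
  The gain quantities are given by the same formulas for both sensors and depend on the sensor
  only through its stream.
\<close>

definition mean_square :: "'t::finite stream \<Rightarrow> real" where
  "mean_square x = 1 / (3 * real CARD('t)) * (\<Sum>a\<in>UNIV. \<Sum>t\<in>UNIV. (x $ a $ t)\<^sup>2)"

definition rho_norm :: "real \<Rightarrow> 't::finite stream \<Rightarrow> real" where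
  "rho_norm \<epsilon> x = max \<epsilon> (sqrt (mean_square x))"

definition normalize_gain :: "real \<Rightarrow> 't::finite stream \<Rightarrow> 't stream" where
  "normalize_gain \<epsilon> x = x /\<^sub>R rho_norm \<epsilon> x"

definition log_rms :: "'t::finite stream \<Rightarrow> ereal" where
  "log_rms x = (if mean_square x = 0 then - \<infinity> else ereal (1 / 2 * ln (mean_square x)))"

datatype sensor = ACC | GYR

definition head_descriptor ::
  "real \<Rightarrow> nat \<Rightarrow> ('c::finite \<Rightarrow> nat \<Rightarrow> real) \<Rightarrow> (real \<Rightarrow> real) \<Rightarrow> nat \<Rightarrow>
   (sensor \<Rightarrow> 't::finite stream) \<Rightarrow> (real ^ 'c) \<times> (real ^ 'c) \<times> ereal \<times> ereal" where
  "head_descriptor \<epsilon> \<kappa> W \<psi> k x =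
     (GAP (box k (ytilde \<kappa> W \<psi> (normalize_gain \<epsilon> (x ACC)))),
      GAP (box k (ytilde \<kappa> W \<psi> (normalize_gain \<epsilon> (x GYR)))),
      log_rms (x ACC),
      log_rms (x GYR))"

definition E_log :: "real \<times> real \<Rightarrow> (real ^ 'c) \<times> (real ^ 'c) \<times> ereal \<times> ereal" where
  "E_log u = (0, 0, ereal (fst u), ereal (snd u))"

end

theory Submission
  imports Defs
begin

text \<open>The filters mix time samples within one axis with weights that do not depend on the
  axis, while \<open>R\<close> mixes axes at one fixed time. The two operations therefore commute
  (\<open>circ_conv_axis_act\<close>), and the Euclidean norm inside \<open>ytilde\<close> erases
  \<open>R\<close>. Filtering and box smoothing are combinations of delays, which commute with
  \<open>shift\<close>; pooling over the whole cyclic group then erases the shift, since translation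
  permutes the group (\<open>sum_UNIV_diff\<close>). The gain \<open>mean_square\<close> is
  invariant under both actions and quadratic under scaling. Hence normalization is equivariant for
  both actions, above the floor it cancels a positive factor, and the logarithm turns that factor
  into an additive constant. The statements on the head descriptor combine these facts entry by
  entry.\<close>

lemma sum_UNIV_diff:
  fixes g :: "'a::{finite,group_add} \<Rightarrow> 'b::comm_monoid_add"
  shows "(\<Sum>t\<in>UNIV. g (t - \<tau>)) = (\<Sum>t\<in>UNIV. g t)"
  by (rule sum.reindex_bij_witness[where i = "\<lambda>t. t + \<tau>" and j = "\<lambda>t. t - \<tau>"]) auto

lemma norm_orthogonal_matrix_vector_mult:
  fixes R :: "real ^ 'n ^ 'n"
  assumes "orthogonal_matrix R"
  shows "norm (R *v v) = norm v"
  using assms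
  by (metis matrix_of_matrix_vector_mul matrix_vector_mul_linear
      orthogonal_transformation_matrix orthogonal_transformation_norm)

lemma GAP_shift: "GAP (shift \<tau> f) = GAP f"
  by (simp add: GAP_def shift_def vec_eq_iff sum_UNIV_diff[where g = "\<lambda>t. f $ c $ t" for c])

text \<open>Delays by \<open>j\<close> and by \<open>\<tau>\<close> commute because the time group
  is abelian. The same reason gives \<open>ytilde_shift\<close>, as \<psi> and the norm act at each
  time separately.\<close>

lemma box_shift: "box k (shift \<tau> f) = shift \<tau> (box k f)"
  by (simp add: box_def shift_def vec_eq_iff diff_diff_eq add.commute)

lemma ytilde_shift: "ytilde \<kappa> W \<psi> (shift \<tau> x) = shift \<tau> (ytilde \<kappa> W \<psi> x)"
  by (simp add: ytilde_def circ_conv_def shift_def vec_eq_iff diff_diff_eq add.commute)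

lemma circ_conv_axis_act:
  "(\<chi> a. circ_conv \<kappa> W (axis_act R x) $ a $ c $ t) = R *v (\<chi> a. circ_conv \<kappa> W x $ a $ c $ t)"
proof -
  \<comment> \<open>Exchanging the sum over taps with the sum over axes is possible with a single
    weight \<open>W c j\<close> for all axes; this is where axis sharing enters.\<close>
  have "(\<Sum>j<\<kappa>. \<Sum>b\<in>UNIV. W c j * (R $ a $ b * x $ b $ (t - of_int_mod_ring (int j)))) =
        (\<Sum>b\<in>UNIV. \<Sum>j<\<kappa>. R $ a $ b * (W c j * x $ b $ (t - of_int_mod_ring (int j))))" for a
    by (subst sum.swap) (simp add: mult.left_commute)
  then show ?thesis
    by (simp add: circ_conv_def axis_act_def sample_def matrix_vector_mult_def vec_eq_iff
        sum_distrib_left)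
qed

lemma ytilde_axis_act:
  assumes "orthogonal_matrix R"
  shows "ytilde \<kappa> W \<psi> (axis_act R x) = ytilde \<kappa> W \<psi> x"
  by (simp add: ytilde_def circ_conv_axis_act norm_orthogonal_matrix_vector_mult[OF assms])

text \<open>With time as the outer sum, the gain depends on the stream only through the norms of its
  samples, which makes its invariance under orthogonal matrices immediate.\<close>

lemma mean_square_eq_sum_norm:
  fixes x :: "'t::finite stream"
  shows "mean_square x = 1 / (3 * real CARD('t)) * (\<Sum>t\<in>UNIV. (norm (sample x t))\<^sup>2)"
proof -
  have "(norm (sample x t))\<^sup>2 = (\<Sum>a\<in>UNIV. (x $ a $ t)\<^sup>2)" for t
    by (simp add: sample_def norm_vec_def L2_set_def sum_nonneg)
  then show ?thesis
    unfolding mean_square_def by (subst sum.swap) simp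
qed

lemma mean_square_axis_act:
  assumes "orthogonal_matrix R"
  shows "mean_square (axis_act R x) = mean_square x"
proof -
  have "sample (axis_act R x) t = R *v sample x t" for t
    by (simp add: sample_def axis_act_def vec_eq_iff)
  then show ?thesis
    by (simp add: mean_square_eq_sum_norm norm_orthogonal_matrix_vector_mult[OF assms])
qed

lemma mean_square_shift: "mean_square (shift \<tau> x) = mean_square x"
  by (simp add: mean_square_def shift_def sum_UNIV_diff[where g = "\<lambda>t. (x $ a $ t)\<^sup>2" for a])

lemma mean_square_scaleR: "mean_square (l *\<^sub>R x) = l\<^sup>2 * mean_square x"
  by (simp add: mean_square_def power_mult_distrib sum_distrib_left mult_ac)

lemma axis_act_scaleR: "axis_act R (l *\<^sub>R x) = l *\<^sub>R axis_act R x"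
  by (simp add: axis_act_def sample_def matrix_vector_mult_def vec_eq_iff sum_distrib_left mult_ac)

lemma shift_scaleR: "shift \<tau> (l *\<^sub>R x) = l *\<^sub>R shift \<tau> x"
  by (simp add: shift_def vec_eq_iff)

lemma normalize_gain_axis_act:
  assumes "orthogonal_matrix R"
  shows "normalize_gain \<epsilon> (axis_act R x) = axis_act R (normalize_gain \<epsilon> x)"
  by (simp add: normalize_gain_def rho_norm_def mean_square_axis_act[OF assms] axis_act_scaleR)

lemma normalize_gain_shift:
  "normalize_gain \<epsilon> (shift \<tau> x) = shift \<tau> (normalize_gain \<epsilon> x)"
  by (simp add: normalize_gain_def rho_norm_def mean_square_shift shift_scaleR)

text \<open>The two bounds make the maximum in \<open>rho_norm\<close> equal to the root mean square
  both before and after scaling, so \<open>l\<close> appears in numerator and denominator and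
  cancels.\<close>

lemma normalize_gain_scaleR:
  assumes "l > 0" "\<epsilon> \<le> sqrt (mean_square x)" "\<epsilon> \<le> l * sqrt (mean_square x)"
  shows "normalize_gain \<epsilon> (l *\<^sub>R x) = normalize_gain \<epsilon> x"
proof -
  have "sqrt (mean_square (l *\<^sub>R x)) = l * sqrt (mean_square x)"
    using assms(1) by (simp add: mean_square_scaleR real_sqrt_mult)
  then show ?thesis
    using assms by (simp add: normalize_gain_def rho_norm_def max_absorb2)
qed

text \<open>The gain acquires the factor \<open>l\<^sup>2\<close>, and the 1/2 in front of the
  logarithm absorbs the square. Positivity keeps both sides away from the value minus
  infinity.\<close>

lemma log_rms_scaleR:
  assumes "l > 0" "mean_square x > 0"
  shows "log_rms (l *\<^sub>R x) = log_rms x + ereal (ln l)"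
  using assms by (simp add: log_rms_def mean_square_scaleR ln_mult ln_realpow algebra_simps)

text \<open>In the pooled entries both actions move outward through the normalization;
  \<open>R\<close> disappears at \<open>ytilde\<close>, whereas the shift passes on through
  \<open>box\<close> and disappears at \<open>GAP\<close>. The log entries depend on the gain
  alone.\<close>

lemma head_descriptor_axis_act_shift:
  assumes "orthogonal_matrix R"
  shows "head_descriptor \<epsilon> \<kappa> W \<psi> k (\<lambda>s. axis_act R (shift \<tau> (x s))) =
         head_descriptor \<epsilon> \<kappa> W \<psi> k x"
  by (simp add: head_descriptor_def log_rms_def normalize_gain_axis_act[OF assms]
      normalize_gain_shift ytilde_axis_act[OF assms] ytilde_shift box_shift GAP_shift
      mean_square_axis_act[OF assms] mean_square_shift)

lemma head_descriptor_scaleR: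
  assumes "\<epsilon> > 0" "\<And>s. lam s > 0"
    and "\<And>s. \<epsilon> \<le> sqrt (mean_square (x s))" "\<And>s. \<epsilon> \<le> lam s * sqrt (mean_square (x s))"
  shows "head_descriptor \<epsilon> \<kappa> W \<psi> k (\<lambda>s. lam s *\<^sub>R x s) =
         head_descriptor \<epsilon> \<kappa> W \<psi> k x + E_log (ln (lam ACC), ln (lam GYR))"
proof -
  \<comment> \<open>The positive floor lies below the root mean square, so both log-RMS entries are
    finite and \<open>log_rms_scaleR\<close> applies.\<close>
  have "mean_square (x s) > 0" for s
    using less_le_trans[OF assms(1) assms(3)[of s]] by simp
  then show ?thesis
    using assms by (simp add: head_descriptor_def E_log_def normalize_gain_scaleR log_rms_scaleR)
qed

theorem proposition1:
  fixes W :: "'c::finite \<Rightarrow> nat \<Rightarrow> real"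
    and \<psi> :: "real \<Rightarrow> real"
    and \<kappa> k :: nat
    and \<epsilon> :: real
  assumes "\<kappa> \<ge> 1" and "k \<ge> 1" and "\<epsilon> > 0"
  shows
    "(\<forall>(x :: 't::finite stream) (R :: real ^ 3 ^ 3) (\<tau> :: 't mod_ring). orthogonal_matrix R \<longrightarrow>
        ytilde \<kappa> W \<psi> (axis_act R x) = ytilde \<kappa> W \<psi> x \<and>
        GAP (shift \<tau> (ytilde \<kappa> W \<psi> x)) = GAP (ytilde \<kappa> W \<psi> x))
     \<and>
     (\<forall>(s :: sensor) (x :: 't stream) (lam :: sensor \<Rightarrow> real). lam s > 0 \<longrightarrow>
        (sqrt (mean_square x) \<ge> \<epsilon> \<and> lam s * sqrt (mean_square x) \<ge> \<epsilon> \<longrightarrow>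
           normalize_gain \<epsilon> (lam s *\<^sub>R x) = normalize_gain \<epsilon> x) \<and>
        (mean_square x > 0 \<longrightarrow>
           log_rms (lam s *\<^sub>R x) = log_rms x + ereal (ln (lam s))))
     \<and>
     (\<forall>(x :: sensor \<Rightarrow> 't stream) (R :: real ^ 3 ^ 3) (\<tau> :: 't mod_ring). orthogonal_matrix R \<longrightarrow>
        head_descriptor \<epsilon> \<kappa> W \<psi> k (\<lambda>s. axis_act R (shift \<tau> (x s))) =
        head_descriptor \<epsilon> \<kappa> W \<psi> k x)
     \<and>
     (\<forall>(x :: sensor \<Rightarrow> 't stream) (lam :: sensor \<Rightarrow> real).
        (\<forall>s. lam s > 0) \<and>
        (\<forall>s. sqrt (mean_square (x s)) \<ge> \<epsilon> \<and> lam s * sqrt (mean_square (x s)) \<ge> \<epsilon>) \<longrightarrow>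
        head_descriptor \<epsilon> \<kappa> W \<psi> k (\<lambda>s. lam s *\<^sub>R x s) =
        head_descriptor \<epsilon> \<kappa> W \<psi> k x + E_log (ln (lam ACC), ln (lam GYR)))"
  by (intro conjI allI impI) (use assms(3) in \<open>auto simp: ytilde_axis_act GAP_shift normalize_gain_scaleR log_rms_scaleR
    head_descriptor_axis_act_shift intro!: head_descriptor_scaleR\<close>)

end
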